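(* Let $G,H$ be graphs with $G,H\in\mathfrak{N}$, where $H$ is $r$-regular, and let $n=|V(H)|$. Then the lexicographic product $G[H]$ belongs to $\mathfrak{N}$. Moreover, $w(G[H])\leq w(G)\cdot n+r$ and $W(G[H])\geq W(G)\cdot n+r$.
   Context: All graphs are finite, undirected, without loops or multiple edges. An edge coloring of a graph $G$ with colors $1,2,\ldots,t$ is an interval $t$-coloring if every color $i\in\{1,\ldots,t\}$ is used on at least one edge, and for every vertex $v$ the colors of the edges incident to $v$ are pairwise distinct and form an interval of consecutive integers. $G$ is interval colorable if it has an interval $t$-coloring for some integer $t\geq 1$; $\mathfrak{N}$ denotes the set of interval colorable graphs. For $G\in\mathfrak{N}$, $w(G)$ and $W(G)$ denote the least and greatest $t$ for which $G$ has an interval $t$-coloring. The lexicographic product $G[H]$ has vertex set $V(G)\times V(H)$, with $(u_1,v_1)$ adjacent to $(u_2,v_2)$ iff either $u_1u_2\in E(G)$, or ($u_1=u_2$ and $v_1v_2\in E(H)$). *)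

theory Defs
  imports "Graph_Theory.Pair_Digraph"
begin

text \<open>
  Finite, undirected graphs without loops and multiple edges are the \<^locale>\<open>pair_graph\<close>s:
  both arcs \<open>(u, v)\<close> and \<open>(v, u)\<close> stand for the same undirected edge \<open>{u, v}\<close>.  Edge colorings
  are functions on these undirected edges.
\<close>

definition uedges :: "'a pair_pre_digraph \<Rightarrow> 'a set set" where
  "uedges G = {{u, v} |u v. (u, v) \<in> parcs G}"

definition incident_edges :: "'a pair_pre_digraph \<Rightarrow> 'a \<Rightarrow> 'a set set" where
  "incident_edges G v = {e \<in> uedges G. v \<in> e}"

definition regular :: "'a pair_pre_digraph \<Rightarrow> nat \<Rightarrow> bool" where
  "regular G r \<longleftrightarrow> (\<forall>v \<in> pverts G. card (incident_edges G v) = r)"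

text \<open>
  The interval of colors at a vertex may be empty, so isolated vertices impose no condition.  Since
  \<open>t \<ge> 1\<close> and all colors are used, a graph without edges has no interval coloring.
\<close>

definition interval_coloring :: "'a pair_pre_digraph \<Rightarrow> nat \<Rightarrow> ('a set \<Rightarrow> nat) \<Rightarrow> bool" where
  "interval_coloring G t c \<longleftrightarrow>
     t \<ge> 1 \<and>
     c ` uedges G = {1..t} \<and>
     (\<forall>v \<in> pverts G. inj_on c (incident_edges G v) \<and>
                     (\<exists>a b. c ` incident_edges G v = {a..b}))"

definition has_interval_coloring :: "'a pair_pre_digraph \<Rightarrow> nat \<Rightarrow> bool" where
  "has_interval_coloring G t \<longleftrightarrow> (\<exists>c. interval_coloring G t c)"

definition interval_colorable :: "'a pair_pre_digraph \<Rightarrow> bool" where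
  "interval_colorable G \<longleftrightarrow> (\<exists>t. has_interval_coloring G t)"

definition w_min :: "'a pair_pre_digraph \<Rightarrow> nat" where
  "w_min G = (LEAST t. has_interval_coloring G t)"

definition W_max :: "'a pair_pre_digraph \<Rightarrow> nat" where
  "W_max G = (GREATEST t. has_interval_coloring G t)"

definition lex_product ::
    "'a pair_pre_digraph \<Rightarrow> 'b pair_pre_digraph \<Rightarrow> ('a \<times> 'b) pair_pre_digraph" where
  "lex_product G H =
     \<lparr> pverts = pverts G \<times> pverts H,
       parcs = {((u1, v1), (u2, v2)) |u1 v1 u2 v2.
                  u1 \<in> pverts G \<and> u2 \<in> pverts G \<and> v1 \<in> pverts H \<and> v2 \<in> pverts H \<and>
                  ((u1, u2) \<in> parcs G \<or> u1 = u2 \<and> (v1, v2) \<in> parcs H)} \<rparr>"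

lemma pair_graph_lex_product:
  assumes "pair_graph G" "pair_graph H"
  shows "pair_graph (lex_product G H)"
proof -
  interpret G: pair_graph G by fact
  interpret H: pair_graph H by fact
  have sG: "(v, u) \<in> parcs G" if "(u, v) \<in> parcs G" for u v
    using G.pair_sym_arcs that by (auto simp: symmetric_def sym_def)
  have sH: "(v, u) \<in> parcs H" if "(u, v) \<in> parcs H" for u v
    using H.pair_sym_arcs that by (auto simp: symmetric_def sym_def)
  have fin: "finite (pverts G \<times> pverts H)"
    using G.pair_finite_verts H.pair_finite_verts by simp
  have "parcs (lex_product G H) \<subseteq> (pverts G \<times> pverts H) \<times> (pverts G \<times> pverts H)"
    by (auto simp: lex_product_def)
  then have "finite (parcs (lex_product G H))"
    by (rule finite_subset) (use fin in blast)
  then show ?thesis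
    using fin G.pair_no_loops H.pair_no_loops
    by unfold_locales (auto simp: lex_product_def symmetric_def sym_def intro: sG sH)
qed

text \<open>
  The number of colors is bounded by the number of edges, so \<^const>\<open>W_max\<close> is attained for every
  finite interval colorable graph.
\<close>

lemma finite_uedges:
  assumes "pair_graph G"
  shows "finite (uedges G)"
proof -
  interpret pair_graph G by fact
  have "uedges G = (\<lambda>(u, v). {u, v}) ` parcs G"
    by (auto simp: uedges_def)
  then show ?thesis using pair_finite_arcs by simp
qed

lemma has_interval_coloring_le:
  assumes "pair_graph G" "has_interval_coloring G t"
  shows "t \<le> card (uedges G)"
proof -
  from assms(2) obtain c where "c ` uedges G = {1..t}"
    by (auto simp: has_interval_coloring_def interval_coloring_def)
  then show ?thesis
    using card_image_le[OF finite_uedges[OF assms(1)], of c] by simp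
qed

lemma has_interval_coloring_w_min:
  assumes "interval_colorable G"
  shows "has_interval_coloring G (w_min G)"
  using assms unfolding interval_colorable_def w_min_def by (auto intro: LeastI)

lemma has_interval_coloring_W_max:
  assumes "pair_graph G" "interval_colorable G"
  shows "has_interval_coloring G (W_max G)"
  using assms has_interval_coloring_le[OF assms(1)]
  unfolding interval_colorable_def W_max_def by (auto intro: GreatestI_nat)

lemma le_W_max:
  assumes "pair_graph G" "has_interval_coloring G t"
  shows "t \<le> W_max G"
  using assms has_interval_coloring_le[OF assms(1)]
  unfolding W_max_def by (auto intro: Greatest_le_nat)

end

theory Submission
  imports Defs
begin

text \<open>
  Reducing an interval coloring of the \<open>r\<close>-regular graph \<open>H\<close> modulo \<open>r\<close> gives a proper edge coloring
  with \<open>r\<close> colors, all of which occur at every vertex.  Let \<open>g\<close> be an interval \<open>t\<close>-coloring of \<open>G\<close>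
  in which the colors at \<open>u\<close> are \<open>{a..b}\<close>.  Every edge of \<open>G\<close> of color \<open>i\<close> becomes a copy of the
  complete bipartite graph \<open>K\<^sub>n\<^sub>,\<^sub>n\<close> in \<open>G[H]\<close>, which is colored by a symmetric Latin square with the
  block of colors \<open>{(i - 1) * n + 1..i * n}\<close>; the copy of \<open>H\<close> over \<open>u\<close> gets the next \<open>r\<close> colors
  \<open>{b * n + 1..b * n + r}\<close>.  The colors at a vertex over \<open>u\<close> are then \<open>{(a - 1) * n + 1..b * n + r}\<close>,
  and altogether exactly \<open>t * n + r\<close> colors occur.
\<close>

section \<open>Interval colorings as symmetric functions on pairs of vertices\<close>

text \<open>A doubleton determines its two elements up to exchange, so a symmetric function takes
  the same value on every representation of an edge. This lets colorings be built without handling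
  edges as sets.\<close>

lemma ex_edge_function:
  assumes "\<And>u v. f u v = f v u"
  shows "\<exists>c. \<forall>u v. c {u, v} = f u v"
proof -
  define c where "c e = (SOME k. \<exists>u v. e = {u, v} \<and> k = f u v)" for e
  have "c {u, v} = f u v" for u v
    unfolding c_def by (rule some_equality) (use assms in \<open>auto simp: doubleton_eq_iff\<close>)
  then show ?thesis by blast
qed

lemma pair_graph_arc_sym:
  assumes "pair_graph G" "(u, v) \<in> parcs G"
  shows "(v, u) \<in> parcs G"
proof -
  interpret pair_graph G by fact
  show ?thesis using pair_sym_arcs assms(2) by (auto simp: symmetric_def sym_def)
qed

lemma pair_graph_arc_verts:
  assumes "pair_graph G" "(u, v) \<in> parcs G"
  shows "u \<in> pverts G" "v \<in> pverts G" "u \<noteq> v"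
proof -
  interpret pair_graph G by fact
  show "u \<in> pverts G" "v \<in> pverts G" "u \<noteq> v"
    using arc_fst_in_verts[OF assms(2)] arc_snd_in_verts[OF assms(2)] pair_no_loops[OF assms(2)]
    by simp_all
qed

lemma incident_edges_eq:
  assumes "pair_graph G"
  shows "incident_edges G v = (\<lambda>w. {v, w}) ` (parcs G `` {v})"
  using pair_graph_arc_sym[OF assms]
  by (auto simp: incident_edges_def uedges_def doubleton_eq_iff image_iff)

lemma inj_on_doubleton: "inj_on (\<lambda>w. {v, w}) A"
  by (auto simp: inj_on_def doubleton_eq_iff)

lemma regular_iff_card_neighbors:
  assumes "pair_graph G"
  shows "regular G r \<longleftrightarrow> (\<forall>v \<in> pverts G. card (parcs G `` {v}) = r)"
  by (simp add: regular_def incident_edges_eq[OF assms] card_image[OF inj_on_doubleton])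

lemma uedges_eq_Union:
  assumes "pair_graph G"
  shows "uedges G = (\<Union>v \<in> pverts G. (\<lambda>w. {v, w}) ` (parcs G `` {v}))"
  using pair_graph_arc_verts[OF assms] by (auto simp: uedges_def image_iff)

text \<open>Sending a neighbor \<open>w\<close> of \<open>v\<close> to the edge
  \<open>{v, w}\<close> is injective, so properness and the interval condition at \<open>v\<close>
  merge into one bijection from the neighborhood onto an interval.\<close>

lemma has_interval_coloring_iff:
  assumes "pair_graph G"
  shows "has_interval_coloring G t \<longleftrightarrow> t \<ge> 1 \<and>
    (\<exists>f. (\<forall>u v. f u v = f v u) \<and> (\<Union>v \<in> pverts G. f v ` (parcs G `` {v})) = {1..t} \<and>
         (\<forall>v \<in> pverts G. \<exists>a b. bij_betw (f v) (parcs G `` {v}) {a..b}))"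
    (is "_ \<longleftrightarrow> _ \<and> (\<exists>f. ?P f)")
proof -
  have inj: "inj_on c (incident_edges G v) \<longleftrightarrow> inj_on (\<lambda>w. c {v, w}) (parcs G `` {v})" for c v
    using comp_inj_on_iff[OF inj_on_doubleton, of c v "parcs G `` {v}"]
    by (simp add: incident_edges_eq[OF assms] comp_def)
  have img: "c ` incident_edges G v = (\<lambda>w. c {v, w}) ` (parcs G `` {v})" for c v
    by (simp add: incident_edges_eq[OF assms] image_image)
  have all: "c ` uedges G = (\<Union>v \<in> pverts G. (\<lambda>w. c {v, w}) ` (parcs G `` {v}))" for c
    by (simp add: uedges_eq_Union[OF assms] image_UN image_image)
  have *: "interval_coloring G t c \<longleftrightarrow> t \<ge> 1 \<and> ?P (\<lambda>u v. c {u, v})" for c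
  proof -
    have "\<forall>u v. c {u, v} = c {v, u}" by (simp add: insert_commute)
    then show ?thesis
      by (simp only: interval_coloring_def inj img all bij_betw_def ex_simps simp_thms)
  qed
  show ?thesis
  proof
    assume "has_interval_coloring G t"
    then obtain c where "interval_coloring G t c" by (auto simp: has_interval_coloring_def)
    then show "t \<ge> 1 \<and> (\<exists>f. ?P f)" unfolding * by (intro conjI exI[of _ "\<lambda>u v. c {u, v}"]) simp_all
  next
    assume ex: "t \<ge> 1 \<and> (\<exists>f. ?P f)"
    then have t: "t \<ge> 1" by (rule conjunct1)
    from ex obtain f where f: "?P f" by (rule conjunct2[THEN exE])
    obtain c where c: "\<forall>u v. c {u, v} = f u v"
      using ex_edge_function[of f] f[THEN conjunct1] by auto
    have "?P (\<lambda>u v. c {u, v})" unfolding c[rule_format] by (rule f)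
    with t have "interval_coloring G t c" unfolding * by (rule conjI)
    then show "has_interval_coloring G t" by (auto simp: has_interval_coloring_def)
  qed
qed

lemma has_interval_coloringE:
  assumes "pair_graph G" "has_interval_coloring G t"
  obtains f where "t \<ge> 1" "\<And>u v. f u v = f v u"
    "(\<Union>v \<in> pverts G. f v ` (parcs G `` {v})) = {1..t}"
    "\<And>v. v \<in> pverts G \<Longrightarrow> \<exists>a b. bij_betw (f v) (parcs G `` {v}) {a..b}"
proof -
  note ex = assms(2)[unfolded has_interval_coloring_iff[OF assms(1)]]
  from ex obtain f where f: "(\<forall>u v. f u v = f v u) \<and>
      (\<Union>v \<in> pverts G. f v ` (parcs G `` {v})) = {1..t} \<and>
      (\<forall>v \<in> pverts G. \<exists>a b. bij_betw (f v) (parcs G `` {v}) {a..b})"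
    by (rule conjunct2[THEN exE])
  show thesis
  proof (rule that)
    show "t \<ge> 1" using ex by (rule conjunct1)
    show "f u v = f v u" for u v using f by simp
    show "(\<Union>v \<in> pverts G. f v ` (parcs G `` {v})) = {1..t}" using f by simp
    show "\<exists>a b. bij_betw (f v) (parcs G `` {v}) {a..b}" if "v \<in> pverts G" for v
      using f that by simp
  qed
qed

section \<open>The two ingredients of the coloring\<close>

text \<open>Any \<open>r\<close> consecutive integers form a complete residue system modulo
  \<open>r\<close>; adding 1 turns the residues into colors that start at 1.\<close>

lemma bij_betw_mod_interval:
  fixes a b r :: nat
  assumes "card {a..b} = r"
  shows "bij_betw (\<lambda>k. k mod r + 1) {a..b} {1..r}"
proof -
  have inj: "inj_on (\<lambda>k. k mod r + 1) {a..b}"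
  proof (rule linorder_inj_onI)
    fix x y assume xy: "x < y" "x \<in> {a..b}" "y \<in> {a..b}"
    show "x mod r + 1 \<noteq> y mod r + 1"
    proof
      assume "x mod r + 1 = y mod r + 1"
      \<comment> \<open>Distinct congruent numbers differ by at least \<open>r\<close>, while two
        elements of the interval differ by at most \<open>r - 1\<close>.\<close>
      then have "r dvd y - x" using xy(1) mod_eq_dvd_iff_nat[of x y r] by simp
      then have "r \<le> y - x" using xy(1) by (simp add: dvd_imp_le)
      then show False using xy assms by auto
    qed
  qed auto
  have "(\<lambda>k. k mod r + 1) ` {a..b} \<subseteq> {1..r}"
    using assms by (cases "r = 0") (auto simp: Suc_le_eq)
  then have "(\<lambda>k. k mod r + 1) ` {a..b} = {1..r}"
    by (rule card_subset_eq[rotated]) (use card_image[OF inj] assms in auto)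
  with inj show ?thesis by (simp add: bij_betw_def)
qed

text \<open>By regularity the interval at each vertex has length \<open>r\<close>, so reduction
  modulo \<open>r\<close> makes the set of colors the same at all vertices, wherever their intervals
  began.\<close>

lemma regular_interval_colorable_imp_full_coloring:
  assumes "pair_graph H" "interval_colorable H" "regular H r"
  obtains h :: "'b \<Rightarrow> 'b \<Rightarrow> nat" where "\<And>u v. h u v = h v u"
    "\<And>v. v \<in> pverts H \<Longrightarrow> bij_betw (h v) (parcs H `` {v}) {1..r}"
proof -
  obtain f where sym: "\<And>u v. f u v = f v u"
    and bij: "\<And>v. v \<in> pverts H \<Longrightarrow> \<exists>a b::nat. bij_betw (f v) (parcs H `` {v}) {a..b}"
    using assms(2) unfolding interval_colorable_def
    by (elim exE has_interval_coloringE[OF assms(1)]) (rule that)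
  show thesis
  proof
    show "f u v mod r + 1 = f v u mod r + 1" for u v using sym by simp
    fix v assume v: "v \<in> pverts H"
    obtain a b where ab: "bij_betw (f v) (parcs H `` {v}) {a..b}" using bij[OF v] by blast
    have "card {a..b} = r"
      using bij_betw_same_card[OF ab] assms(3) v by (simp add: regular_iff_card_neighbors[OF assms(1)])
    from bij_betw_trans[OF ab bij_betw_mod_interval[OF this]]
    show "bij_betw (\<lambda>w. f v w mod r + 1) (parcs H `` {v}) {1..r}" by (simp add: comp_def)
  qed
qed

text \<open>This is the addition table of the integers modulo \<open>card V\<close>, carried over to
  \<open>V\<close> by an enumeration; it is symmetric since addition commutes.\<close>

lemma ex_symmetric_latin_square:
  assumes "finite V"
  obtains L :: "'b \<Rightarrow> 'b \<Rightarrow> nat" where "\<And>x y. L x y = L y x"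
    "\<And>x. bij_betw (L x) V {1..card V}"
proof -
  obtain idx where idx: "bij_betw idx V {0..<card V}" using ex_bij_betw_finite_nat[OF assms] by blast
  show thesis
  proof
    show "(idx x + idx y) mod card V + 1 = (idx y + idx x) mod card V + 1" for x y
      by (simp add: add.commute)
    fix x
    show "bij_betw (\<lambda>y. (idx x + idx y) mod card V + 1) V {1..card V}"
    proof (cases "card V = 0")
      case True
      then have "V = {}" using assms by simp
      then show ?thesis by (simp add: bij_betw_def)
    next
      case False
      \<comment> \<open>Before reduction, row \<open>x\<close> runs through \<open>card V\<close>
        consecutive integers from \<open>idx x\<close> on.\<close>
      have "card {idx x..idx x + card V - 1} = card V" using False by simp
      note * = bij_betw_mod_interval[OF this]
      have "(\<lambda>k. idx x + k) ` {0..<card V} = {idx x..idx x + card V - 1}"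
        using False by (simp add: image_add_atLeastLessThan) auto
      then have "bij_betw (\<lambda>k. idx x + k) {0..<card V} {idx x..idx x + card V - 1}"
        by (simp add: bij_betw_def)
      from bij_betw_trans[OF bij_betw_trans[OF idx this] *] show ?thesis by (simp add: comp_def)
    qed
  qed
qed

text \<open>Division of \<open>k - 1\<close> by \<open>n\<close> with remainder recovers the block
  and the position of color \<open>k\<close>. Since subtraction is truncated, blocks 0 and 1 would
  coincide, hence \<open>a \<ge> 1\<close>.\<close>

lemma bij_betw_blocks:
  fixes a b n :: nat
  assumes "a \<ge> 1"
  shows "bij_betw (\<lambda>(i, x). (i - 1) * n + x) ({a..b} \<times> {1..n}) {(a - 1) * n + 1..b * n}"
proof (rule bij_betw_byWitness[where f' = "\<lambda>k. ((k - 1) div n + 1, (k - 1) mod n + 1)"])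
  show "\<forall>p \<in> {a..b} \<times> {1..n}. (\<lambda>k. ((k - 1) div n + 1, (k - 1) mod n + 1))
      ((\<lambda>(i, x). (i - 1) * n + x) p) = p"
  proof
    fix p assume "p \<in> {a..b} \<times> {1..n}"
    then obtain i x where ix: "p = (i, x)" "i \<in> {a..b}" "x \<in> {1..n}" by blast
    then obtain y where "x = Suc y" "y < n" by (cases x) auto
    then show "(\<lambda>k. ((k - 1) div n + 1, (k - 1) mod n + 1)) ((\<lambda>(i, x). (i - 1) * n + x) p) = p"
      using ix assms by simp
  qed
  show "\<forall>k \<in> {(a - 1) * n + 1..b * n}.
      (\<lambda>(i, x). (i - 1) * n + x) ((k - 1) div n + 1, (k - 1) mod n + 1) = k"
    by auto
  show "(\<lambda>(i, x). (i - 1) * n + x) ` ({a..b} \<times> {1..n}) \<subseteq> {(a - 1) * n + 1..b * n}"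
  proof clarify
    fix i x assume ix: "i \<in> {a..b}" "x \<in> {1..n}"
    have "(a - 1) * n \<le> (i - 1) * n" using ix by (intro mult_right_mono) auto
    moreover have "(i - 1) * n + x \<le> (i - 1) * n + n" using ix by simp
    moreover have "(i - 1) * n + n = i * n" using ix assms by (cases i) auto
    moreover have "i * n \<le> b * n" using ix by simp
    moreover have "1 \<le> x" using ix by simp
    ultimately show "(i - 1) * n + x \<in> {(a - 1) * n + 1..b * n}"
      unfolding atLeastAtMost_iff by linarith
  qed
  show "(\<lambda>k. ((k - 1) div n + 1, (k - 1) mod n + 1)) ` {(a - 1) * n + 1..b * n}
      \<subseteq> {a..b} \<times> {1..n}"
  proof clarify
    fix k assume k: "k \<in> {(a - 1) * n + 1..b * n}"
    then have n: "n > 0" by (cases "n = 0") auto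
    have "(a - 1) * n \<le> k - 1" using k unfolding atLeastAtMost_iff by linarith
    then have "a - 1 \<le> (k - 1) div n" using n by (simp add: less_eq_div_iff_mult_less_eq)
    moreover have "k - 1 < b * n" using k unfolding atLeastAtMost_iff by linarith
    then have "(k - 1) div n < b" using n by (simp add: div_less_iff_less_mult)
    ultimately show "(k - 1) div n + 1 \<in> {a..b} \<and> (k - 1) mod n + 1 \<in> {1..n}"
      using n by (auto simp: Suc_le_eq)
  qed
qed

section \<open>Coloring the lexicographic product\<close>

lemma neighbors_lex_product:
  assumes "pair_graph G" "pair_graph H" "u \<in> pverts G" "v \<in> pverts H"
  shows "parcs (lex_product G H) `` {(u, v)} =
    (parcs G `` {u}) \<times> pverts H \<union> {u} \<times> (parcs H `` {v})"
  using assms(3,4) pair_graph_arc_verts[OF assms(1)] pair_graph_arc_verts[OF assms(2)]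
  by (auto simp: lex_product_def)

lemma has_interval_coloring_lex_product:
  assumes G: "pair_graph G" and H: "pair_graph H"
    and t: "has_interval_coloring G t" and "interval_colorable H" "regular H r"
  shows "has_interval_coloring (lex_product G H) (t * card (pverts H) + r)"
proof -
  define n where "n = card (pverts H)"
  interpret H: pair_graph H by fact
  have fin: "finite (pverts H)" by (rule H.pair_finite_verts)
  obtain g where t1: "t \<ge> 1" and g_sym: "\<And>u v. g u v = g v u"
    and g_all: "(\<Union>u \<in> pverts G. g u ` (parcs G `` {u})) = {1..t}"
    and g_bij: "\<And>u. u \<in> pverts G \<Longrightarrow> \<exists>a b. bij_betw (g u) (parcs G `` {u}) {a..b}"
    by (rule has_interval_coloringE[OF G t]) (rule that)
  obtain h where h_sym: "\<And>u v. h u v = h v u"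
    and h_bij: "\<And>v. v \<in> pverts H \<Longrightarrow> bij_betw (h v) (parcs H `` {v}) {1..r}"
    by (rule regular_interval_colorable_imp_full_coloring[OF assms(2,4,5)]) (rule that)
  obtain L :: "'b \<Rightarrow> 'b \<Rightarrow> nat" where L_sym: "\<And>x y. L x y = L y x"
    and L_bij: "\<And>x. bij_betw (L x) (pverts H) {1..n}"
    by (rule ex_symmetric_latin_square[OF fin, folded n_def]) (rule that)
  \<comment> \<open>An interval coloring uses at least one color, so \<open>H\<close> has an
    edge.\<close>
  have "pverts H \<noteq> {}"
  proof
    assume "pverts H = {}"
    then have "\<not> has_interval_coloring H s" for s
      unfolding has_interval_coloring_iff[OF H] by auto
    with assms(4) show False by (simp add: interval_colorable_def)
  qed
  then have n: "n \<ge> 1" using fin by (simp add: n_def Suc_le_eq card_gt_0_iff)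
  \<comment> \<open>For an isolated vertex the choice \<open>a = 1\<close>, \<open>b = 0\<close> makes the general formulas valid.\<close>
  have "\<exists>a b. a \<ge> 1 \<and> a \<le> b + 1 \<and> b \<le> t \<and> bij_betw (g u) (parcs G `` {u}) {a..b}"
    if u: "u \<in> pverts G" for u
  proof -
    obtain a b where ab: "bij_betw (g u) (parcs G `` {u}) {a..b}" using g_bij[OF u] by blast
    show ?thesis
    proof (cases "a \<le> b")
      case True
      have "{a..b} \<subseteq> {1..t}" using ab u unfolding g_all[symmetric] bij_betw_def by auto
      then show ?thesis using ab True by (intro exI[of _ a] exI[of _ b]) auto
    next
      case False
      then show ?thesis using ab by (intro exI[of _ 1] exI[of _ 0]) simp
    qed
  qed
  then obtain a b where ab: "\<And>u. u \<in> pverts G \<Longrightarrow>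
      a u \<ge> 1 \<and> a u \<le> b u + 1 \<and> b u \<le> t \<and> bij_betw (g u) (parcs G `` {u}) {a u..b u}"
    by metis
  \<comment> \<open>The shift \<open>b (fst p) * n\<close> is symmetric too, because it is used only
    when \<open>fst p = fst q\<close>.\<close>
  define f where "f p q = (if fst p = fst q then b (fst p) * n + h (snd p) (snd q)
      else (g (fst p) (fst q) - 1) * n + L (snd p) (snd q))" for p q
  have f_sym: "f p q = f q p" for p q
    using g_sym h_sym L_sym by (simp add: f_def)
  have f_bij: "bij_betw (f (u, v)) (parcs (lex_product G H) `` {(u, v)})
      {(a u - 1) * n + 1..b u * n + r}" if u: "u \<in> pverts G" and v: "v \<in> pverts H" for u v
  proof -
    \<comment> \<open>For each neighbor of \<open>u\<close>, the row \<open>L v\<close> fills every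
      position of the corresponding block, so consecutive blocks leave no gap.\<close>
    have "bij_betw (map_prod (g u) (L v)) ((parcs G `` {u}) \<times> pverts H) ({a u..b u} \<times> {1..n})"
      using ab[OF u] L_bij by (intro bij_betw_map_prod) auto
    from bij_betw_trans[OF this bij_betw_blocks] ab[OF u]
    have "bij_betw ((\<lambda>(i, x). (i - 1) * n + x) \<circ> map_prod (g u) (L v))
        ((parcs G `` {u}) \<times> pverts H) {(a u - 1) * n + 1..b u * n}" by blast
    \<comment> \<open>As \<open>G\<close> has no loops, these neighbors all fall under the second
      branch of \<open>f\<close>.\<close>
    then have 1: "bij_betw (f (u, v)) ((parcs G `` {u}) \<times> pverts H)
        {(a u - 1) * n + 1..b u * n}"
      by (rule bij_betw_cong[THEN iffD1, rotated])
        (auto simp: f_def dest: pair_graph_arc_verts(3)[OF G])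
    have "bij_betw snd ({u} \<times> (parcs H `` {v})) (parcs H `` {v})"
      by (auto simp: bij_betw_def inj_on_def image_iff)
    moreover have "bij_betw (\<lambda>k. b u * n + k) {1..r} {b u * n + 1..b u * n + r}"
      by (simp add: bij_betw_def)
    ultimately have "bij_betw ((\<lambda>k. b u * n + k) \<circ> (h v \<circ> snd)) ({u} \<times> (parcs H `` {v}))
        {b u * n + 1..b u * n + r}"
      by (intro bij_betw_trans[OF bij_betw_trans[OF _ h_bij[OF v]]])
    then have 2: "bij_betw (f (u, v)) ({u} \<times> (parcs H `` {v})) {b u * n + 1..b u * n + r}"
      by (rule bij_betw_cong[THEN iffD1, rotated]) (auto simp: f_def)
    \<comment> \<open>The case \<open>x = y\<close> covers an isolated \<open>u\<close>, where only
      the colors from the copy of \<open>H\<close> remain.\<close>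
    have "{x + 1..y} \<union> {y + 1..y + r} = {x + 1..y + r}" if "x \<le> y" for x y :: nat
      using that by auto
    moreover have "(a u - 1) * n \<le> b u * n" using ab[OF u] by (intro mult_right_mono) auto
    ultimately have "{(a u - 1) * n + 1..b u * n} \<union> {b u * n + 1..b u * n + r}
        = {(a u - 1) * n + 1..b u * n + r}" by blast
    with bij_betw_combine[OF 1 2] show ?thesis
      by (simp add: neighbors_lex_product[OF G H u v])
  qed
  have UN_prod: "(\<Union>p \<in> A \<times> B. F p) = (\<Union>u \<in> A. \<Union>v \<in> B. F (u, v))"
    for A :: "'a set" and B :: "'b set" and F :: "'a \<times> 'b \<Rightarrow> nat set" by auto
  have verts: "pverts (lex_product G H) = pverts G \<times> pverts H" by (simp add: lex_product_def)
  have "(\<Union>p \<in> pverts (lex_product G H). f p ` (parcs (lex_product G H) `` {p}))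
      = (\<Union>u \<in> pverts G. \<Union>v \<in> pverts H. f (u, v) ` (parcs (lex_product G H) `` {(u, v)}))"
    unfolding verts by (rule UN_prod)
  also have "\<dots> = (\<Union>u \<in> pverts G. \<Union>v \<in> pverts H. {(a u - 1) * n + 1..b u * n + r})"
    by (intro SUP_cong refl bij_betw_imp_surj_on f_bij)
  also have "\<dots> = (\<Union>u \<in> pverts G. {(a u - 1) * n + 1..b u * n + r})"
    using \<open>pverts H \<noteq> {}\<close> by simp
  also have "\<dots> = {1..t * n + r}"
  proof (intro equalityI subsetI)
    fix k assume "k \<in> (\<Union>u \<in> pverts G. {(a u - 1) * n + 1..b u * n + r})"
    then obtain u where u: "u \<in> pverts G" "k \<ge> 1" "k \<le> b u * n + r" by auto
    have "b u * n \<le> t * n" using ab[OF u(1)] by simp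
    with u(2,3) show "k \<in> {1..t * n + r}" unfolding atLeastAtMost_iff by linarith
  next
    fix k assume k: "k \<in> {1..t * n + r}"
    \<comment> \<open>\<open>i\<close> is the block of \<open>k\<close>, capped at \<open>t\<close>
      because the last \<open>r\<close> colors lie beyond all blocks. A vertex of \<open>G\<close>
      that sees color \<open>i\<close> has \<open>k\<close> in its interval in the product.\<close>
    define i where "i = min t ((k - 1) div n + 1)"
    have "i \<in> {1..t}" using t1 by (simp add: i_def)
    then obtain u where u: "u \<in> pverts G" "i \<in> g u ` (parcs G `` {u})"
      unfolding g_all[symmetric] by blast
    then have i: "a u \<le> i" "i \<le> b u" using ab[OF u(1)] by (auto simp: bij_betw_def)
    have "(a u - 1) * n \<le> (i - 1) * n" using i by (intro mult_right_mono) auto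
    also have "\<dots> \<le> (k - 1) div n * n" by (intro mult_right_mono) (auto simp: i_def)
    also have "\<dots> \<le> k - 1" by simp
    finally have lower: "(a u - 1) * n + 1 \<le> k"
      using k unfolding atLeastAtMost_iff by linarith
    have "k - 1 < ((k - 1) div n + 1) * n"
      using n dividend_less_div_times[of n "k - 1"] by simp
    then have "k \<le> ((k - 1) div n + 1) * n" by linarith
    \<comment> \<open>If the cap applies, then \<open>i = t\<close> and the bound is the range of
      \<open>k\<close>; otherwise already \<open>k \<le> i * n\<close>.\<close>
    then have "k \<le> i * n + r" using k by (cases "t \<le> (k - 1) div n + 1") (simp_all add: i_def)
    also have "i * n \<le> b u * n" using i by simp
    finally show "k \<in> (\<Union>u \<in> pverts G. {(a u - 1) * n + 1..b u * n + r})" using lower u by auto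
  qed
  finally have "(\<Union>p \<in> pverts (lex_product G H). f p ` (parcs (lex_product G H) `` {p}))
      = {1..t * n + r}" .
  moreover have "\<exists>x y. bij_betw (f p) (parcs (lex_product G H) `` {p}) {x..y}"
    if "p \<in> pverts (lex_product G H)" for p
    using that f_bij unfolding verts by (cases p) blast
  moreover have "t * n + r \<ge> 1" using t1 n by (simp add: Suc_le_eq)
  ultimately show ?thesis
    unfolding has_interval_coloring_iff[OF pair_graph_lex_product[OF G H]] n_def[symmetric]
    using f_sym by (intro conjI exI[of _ f]) auto
qed

theorem theorem17:
  fixes G :: "'a pair_pre_digraph" and H :: "'b pair_pre_digraph" and r n :: nat
  assumes "pair_graph G" and "pair_graph H"
    and "interval_colorable G" and "interval_colorable H"
    and "regular H r"
    and "n = card (pverts H)"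
  shows "interval_colorable (lex_product G H) \<and>
         w_min (lex_product G H) \<le> w_min G * n + r \<and>
         W_max (lex_product G H) \<ge> W_max G * n + r"
proof -
  note col = has_interval_coloring_lex_product[OF assms(1,2) _ assms(4,5), folded assms(6)]
  \<comment> \<open>Extremal colorings of \<open>G\<close> are fed into the construction: one with
    fewest colors bounds \<open>w_min\<close> from above, one with most colors bounds
    \<open>W_max\<close> from below.\<close>
  note w = col[OF has_interval_coloring_w_min[OF assms(3)]]
  note W = col[OF has_interval_coloring_W_max[OF assms(1,3)]]
  have "interval_colorable (lex_product G H)" using w by (auto simp: interval_colorable_def)
  moreover have "w_min (lex_product G H) \<le> w_min G * n + r"
    using w unfolding w_min_def[of "lex_product G H"] by (rule Least_le)
  moreover have "W_max G * n + r \<le> W_max (lex_product G H)"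
    by (rule le_W_max[OF pair_graph_lex_product[OF assms(1,2)] W])
  ultimately show ?thesis by blast
qed

end
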